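(* For every metrizable space $X$ the following conditions are equivalent: (1) for every metric space $Y$ with more than one point, $vet_1(Q_p(X,Y))=\omega$; (2) there are a metric space $Y$ with more than one point and a function $f\in Q_p(X,Y)$ such that $vet_1(f,Q_p(X,Y))=\omega$; (3) there is a function $f\in Q_p(X,\mathbb{R})$ such that $vet_1(f,Q_p(X,\mathbb{R}))=\omega$; (4) $X$ satisfies $S_1(\mathcal{K}_\Omega,\mathcal{K}_\Omega)$.
   Context: A function $f:X\to Y$ between topological spaces is quasicontinuous if for every $x\in X$, every open $V\ni f(x)$ and every open $U\ni x$ there is a nonempty open $W\subseteq U$ with $f(W)\subseteq V$. $Q(X,Y)$ is the set of all quasicontinuous functions $X\to Y$, and $Q_p(X,Y)$ is $Q(X,Y)$ with the topology of pointwise convergence (the subspace topology from the product $Y^X$). A space $Z$ has countable strong fan-tightness at a point $z\in Z$, written $vet_1(z,Z)=\omega$, if for every sequence $(A_n)_{n\in\omega}$ of subsets of $Z$ with $z\in\bigcap_{n\in\omega}\overline{A_n}$ there are points $a_n\in A_n$ such that $z\in\overline{\{a_n:n\in\omega\}}$. $Z$ has countable strong fan-tightness, written $vet_1(Z)=\omega$, if $vet_1(z,Z)=\omega$ for every $z\in Z$. For a space $X$, $\mathcal{K}_\Omega$ denotes the collection of all families $\mathcal{U}$ of open subsets of $X$ such that $X=\bigcup\{\overline{U}:U\in\mathcal{U}\}$, no element of $\mathcal{U}$ is dense in $X$, and for each finite $F\subseteq X$ there is $U\in\mathcal{U}$ with $F\subseteq\overline{U}$. The space $X$ satisfies $S_1(\mathcal{K}_\Omega,\mathcal{K}_\Omega)$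 if for every sequence $(\mathcal{U}_n)_{n\in\mathbb{N}}$ of elements of $\mathcal{K}_\Omega$ there are $U_n\in\mathcal{U}_n$ ($n\in\mathbb{N}$) such that $\{U_n:n\in\mathbb{N}\}\in\mathcal{K}_\Omega$. *)

theory Defs
  imports "HOL-Analysis.Analysis"
begin

definition quasicontinuous_map :: "'a topology \<Rightarrow> 'b topology \<Rightarrow> ('a \<Rightarrow> 'b) \<Rightarrow> bool" where
  "quasicontinuous_map X Y f \<longleftrightarrow>
     f \<in> topspace X \<rightarrow> topspace Y \<and>
     (\<forall>x \<in> topspace X. \<forall>V U. openin Y V \<and> f x \<in> V \<and> openin X U \<and> x \<in> U \<longrightarrow>
        (\<exists>W. openin X W \<and> W \<noteq> {} \<and> W \<subseteq> U \<and> f ` W \<subseteq> V))"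

text \<open>
  Functions from \<open>X\<close> to \<open>Y\<close> are represented, as in \<^const>\<open>product_topology\<close>, by
  functions that are \<^const>\<open>undefined\<close> outside \<^term>\<open>topspace X\<close>.
\<close>

definition Q_p :: "'a topology \<Rightarrow> 'b topology \<Rightarrow> ('a \<Rightarrow> 'b) topology" where
  "Q_p X Y = subtopology (product_topology (\<lambda>_. Y) (topspace X)) {f. quasicontinuous_map X Y f}"

lemma topspace_Q_p:
  "topspace (Q_p X Y) = {f \<in> extensional (topspace X). quasicontinuous_map X Y f}"
  by (auto simp: Q_p_def quasicontinuous_map_def PiE_def)

definition countable_strong_fan_tightness_at :: "'a topology \<Rightarrow> 'a \<Rightarrow> bool" where
  "countable_strong_fan_tightness_at Z z \<longleftrightarrow>
     (\<forall>A :: nat \<Rightarrow> 'a set.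
        (\<forall>n. A n \<subseteq> topspace Z) \<and> z \<in> (\<Inter>n. Z closure_of (A n)) \<longrightarrow>
        (\<exists>a. (\<forall>n. a n \<in> A n) \<and> z \<in> Z closure_of (range a)))"

definition countable_strong_fan_tightness :: "'a topology \<Rightarrow> bool" where
  "countable_strong_fan_tightness Z \<longleftrightarrow>
     (\<forall>z \<in> topspace Z. countable_strong_fan_tightness_at Z z)"

definition K_Omega :: "'a topology \<Rightarrow> 'a set set set" where
  "K_Omega X = {\<U>.
     (\<forall>U \<in> \<U>. openin X U) \<and>
     topspace X = (\<Union>U \<in> \<U>. X closure_of U) \<and>
     (\<forall>U \<in> \<U>. X closure_of U \<noteq> topspace X) \<and>
     (\<forall>F. finite F \<and> F \<subseteq> topspace X \<longrightarrow> (\<exists>U \<in> \<U>. F \<subseteq> X closure_of U))}"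

definition S_1 :: "'a set set \<Rightarrow> 'a set set \<Rightarrow> bool" where
  "S_1 \<A> \<B> \<longleftrightarrow>
     (\<forall>\<U> :: nat \<Rightarrow> 'a set.
        (\<forall>n. \<U> n \<in> \<A>) \<longrightarrow> (\<exists>u. (\<forall>n. u n \<in> \<U> n) \<and> range u \<in> \<B>))"

text \<open>
  HOL cannot quantify over types inside a formula.  A quantifier over metric spaces therefore
  ranges over \<^typ>\<open>'b metric\<close>, i.e. over all metric spaces carried by a subset of the
  type \<open>'b\<close>, and a theorem using it is stated for every \<open>'b\<close> with at least two elements
  (no other type carries a metric space with more than one point).
\<close>

end

theory Submission
  imports Defs
begin

text \<open>
  Both directions translate between functions and the open sets on which they are prescribed.

  From strong fan tightness at a single \<open>f\<close> to the selection principle: there is a quasicontinuous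
  \<open>h\<close> that differs from \<open>f\<close> at every point (\<open>quasicontinuous_map_nowhere_equal\<close>).  Given families
  \<open>\<U>\<^sub>n\<close>, let \<open>A\<^sub>n\<close> consist of the functions that agree with \<open>h\<close> outside the closure of some
  \<open>U \<in> \<U>\<^sub>n\<close>.  For a finite \<open>F\<close> inside that closure, such a function can be made to agree with \<open>f\<close>
  on \<open>F\<close> (\<open>quasicontinuous_map_interpolate\<close>), so \<open>f\<close> lies in the closure of \<open>A\<^sub>n\<close>.  A selection
  \<open>a\<^sub>n\<close> accumulating at \<open>f\<close> comes with sets \<open>U\<^sub>n\<close>, and as soon as \<open>a\<^sub>n\<close> avoids the values of \<open>h\<close>
  on \<open>F\<close> the closure of \<open>U\<^sub>n\<close> must contain \<open>F\<close>.

  From the selection principle to strong fan tightness at an arbitrary \<open>f\<close>: for \<open>g\<close> near \<open>f\<close> one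
  would like to select among open sets whose closure lies in the set \<open>S\<close> where \<open>g\<close> is close to
  \<open>f\<close>.  In a metrizable space such sets exist around a finite \<open>F\<close> as soon as \<open>F\<close> lies in \<open>S\<close>
  and in the closure of the interior of \<open>S\<close> (\<open>metrizable_open_closure_between\<close>).  The obstacle is
  that two quasicontinuous functions may approach their values at \<open>x\<close> along disjoint open sets, so
  that \<open>S\<close> may have no interior near \<open>x\<close>.  This can only happen where the oscillation of \<open>f\<close> is
  large, on a set \<open>D\<close> that is closed and nowhere dense.  The selection principle itself
  forces such a \<open>D\<close> to be countable (\<open>S_1_imp_closed_nowhere_dense_countable\<close>).  Hence \<open>D\<close> can be
  treated by hand: at stage \<open>n\<close> only those \<open>g\<close> are considered that are close to \<open>f\<close> at the first
  \<open>n\<close> points of \<open>D\<close>, and the closure of the open set may leave \<open>S\<close> inside a neighbourhood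
  of \<open>D\<close> that shrinks to \<open>D\<close> as \<open>n\<close> grows.  Since the members of a family in \<open>\<K>\<^sub>\<Omega>\<close> are not dense, a
  finite set is captured by infinitely many selected sets (\<open>range_in_K_Omega_infinitely_often\<close>), in
  particular at a stage where the neighbourhood no longer matters.  This gives a selection that
  approximates \<open>f\<close> up to one fixed error (\<open>S_1_imp_uniform_selection\<close>); splitting the sequence
  into infinitely many infinite blocks handles all errors at once.
\<close>

section \<open>Quasicontinuous functions\<close>

lemma quasicontinuous_mapD:
  assumes "quasicontinuous_map X Y f" "x \<in> topspace X" "openin Y V" "f x \<in> V" "openin X U" "x \<in> U"
  obtains W where "openin X W" "W \<noteq> {}" "W \<subseteq> U" "f ` W \<subseteq> V"
  using assms unfolding quasicontinuous_map_def by meson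

lemma quasicontinuous_map_in_topspace:
  "quasicontinuous_map X Y f \<Longrightarrow> x \<in> topspace X \<Longrightarrow> f x \<in> topspace Y"
  by (auto simp: quasicontinuous_map_def)

text \<open>
  In other words, preimages of open sets are semi-open.
\<close>
lemma quasicontinuous_map_preimage_subset:
  assumes "quasicontinuous_map X Y f" "openin Y V"
  shows "{x \<in> topspace X. f x \<in> V} \<subseteq> X closure_of (X interior_of {x \<in> topspace X. f x \<in> V})"
proof
  fix x assume x: "x \<in> {x \<in> topspace X. f x \<in> V}"
  have "\<exists>y. y \<in> X interior_of {x \<in> topspace X. f x \<in> V} \<and> y \<in> N" if N: "x \<in> N" "openin X N" for N
  proof -
    obtain W where W: "openin X W" "W \<noteq> {}" "W \<subseteq> N" "f ` W \<subseteq> V"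
      using quasicontinuous_mapD[OF assms(1) _ assms(2) _ N(2,1)] x by blast
    have "W \<subseteq> X interior_of {x \<in> topspace X. f x \<in> V}"
      using W openin_subset[OF W(1)] by (intro interior_of_maximal) auto
    then show ?thesis using W by blast
  qed
  with x show "x \<in> X closure_of (X interior_of {x \<in> topspace X. f x \<in> V})"
    by (auto simp: in_closure_of)
qed

lemma quasicontinuous_map_const: "c \<in> topspace Y \<Longrightarrow> quasicontinuous_map X Y (\<lambda>_. c)"
  unfolding quasicontinuous_map_def by blast

lemma quasicontinuous_map_cong:
  assumes "\<And>x. x \<in> topspace X \<Longrightarrow> f x = g x" "quasicontinuous_map X Y f"
  shows "quasicontinuous_map X Y g"
  unfolding quasicontinuous_map_def
proof (intro conjI ballI allI impI)
  show "g \<in> topspace X \<rightarrow> topspace Y"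
    using assms by (auto simp: quasicontinuous_map_def Pi_iff)
  fix x V U assume x: "x \<in> topspace X" and H: "openin Y V \<and> g x \<in> V \<and> openin X U \<and> x \<in> U"
  then obtain W where W: "openin X W" "W \<noteq> {}" "W \<subseteq> U" "f ` W \<subseteq> V"
    using quasicontinuous_mapD[OF assms(2) x, of V U] assms(1)[OF x] by metis
  have "g ` W \<subseteq> V" using W assms(1) openin_subset[OF W(1)] by (force simp: image_subset_iff)
  with W show "\<exists>W. openin X W \<and> W \<noteq> {} \<and> W \<subseteq> U \<and> g ` W \<subseteq> V" by blast
qed

text \<open>
  At a point of the closure of \<open>V\<close>, also on its boundary, the open sets \<open>W\<close> can be taken inside
  \<open>V\<close>; the remaining points form an open set.
\<close>
lemma quasicontinuous_map_patch:
  assumes g: "quasicontinuous_map X Y g" and V: "openin X V" and c: "c \<in> topspace Y"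
  shows "quasicontinuous_map X Y (\<lambda>z. if z \<in> X closure_of V then c else g z)"
    (is "quasicontinuous_map X Y ?h")
  unfolding quasicontinuous_map_def
proof (intro conjI ballI allI impI)
  show "?h \<in> topspace X \<rightarrow> topspace Y"
    using g c by (auto simp: quasicontinuous_map_def)
  fix x N U assume x: "x \<in> topspace X" and H: "openin Y N \<and> ?h x \<in> N \<and> openin X U \<and> x \<in> U"
  show "\<exists>W. openin X W \<and> W \<noteq> {} \<and> W \<subseteq> U \<and> ?h ` W \<subseteq> N"
  proof (cases "x \<in> X closure_of V")
    case True
    have "?h ` (V \<inter> U) \<subseteq> N"
      using True H closure_of_subset[OF openin_subset[OF V]] by auto
    moreover have "V \<inter> U \<noteq> {}" using True H by (auto simp: in_closure_of)
    moreover have "openin X (V \<inter> U)" using V H by blast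
    ultimately show ?thesis by (meson inf_le2)
  next
    case False
    have "openin X (U - X closure_of V)" using H by (simp add: openin_diff)
    then obtain W where "openin X W" "W \<noteq> {}" "W \<subseteq> U - X closure_of V" "g ` W \<subseteq> N"
      using quasicontinuous_mapD[OF g x, of N "U - X closure_of V"] H x False by auto
    then show ?thesis by (intro exI[of _ W]) auto
  qed
qed

text \<open>
  The function \<open>h\<close> takes only the values \<open>y\<close> and \<open>y'\<close>.  It is \<open>y'\<close> on the interior \<open>Z\<close> of the
  preimage of a neighbourhood of \<open>y\<close>, and \<open>y\<close> on the exterior \<open>G\<close> of \<open>Z\<close>.  A point of the common
  boundary may receive whichever value \<open>f\<close> does not take there, and a boundary point outside the
  closure of \<open>G\<close>, which has to receive \<open>y'\<close>, is harmless because points where \<open>f\<close> equals \<open>y'\<close>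
  are limits of \<open>G\<close>.
\<close>
lemma quasicontinuous_map_nowhere_equal:
  assumes f: "quasicontinuous_map X Y f" and Y: "Hausdorff_space Y"
    and y: "y \<in> topspace Y" "y' \<in> topspace Y" "y \<noteq> y'"
  shows "\<exists>h. quasicontinuous_map X Y h \<and> (\<forall>x \<in> topspace X. h x \<noteq> f x)"
proof -
  obtain B B' where B: "openin Y B" "openin Y B'" "y \<in> B" "y' \<in> B'" "disjnt B B'"
    using Y y by (metis Hausdorff_space_def)
  define Z where "Z = X interior_of {x \<in> topspace X. f x \<in> B}"
  define G where "G = topspace X - X closure_of Z"
  have opZ: "openin X Z" unfolding Z_def by simp
  have opG: "openin X G" unfolding G_def by (simp add: openin_diff)
  have ZB: "f x \<in> B" if "x \<in> Z" for x
    using that interior_of_subset[of X "{x \<in> topspace X. f x \<in> B}"] unfolding Z_def by auto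
  have fy: "x \<in> X closure_of Z" if "x \<in> topspace X" "f x = y" for x
  proof -
    have "x \<in> {x \<in> topspace X. f x \<in> B}" using that B(3) by simp
    then show ?thesis
      using quasicontinuous_map_preimage_subset[OF f B(1)] unfolding Z_def by (rule set_mp[rotated])
  qed
  have ZG: "Z \<inter> X closure_of G = {}"
  proof -
    have "Z \<inter> G = {}" using closure_of_subset[OF openin_subset[OF opZ]] by (auto simp: G_def)
    then show ?thesis using openin_Int_closure_of_eq_empty[OF opZ] by blast
  qed
  have fy': "x \<in> X closure_of G" if x: "x \<in> topspace X" "f x = y'" for x
  proof -
    let ?I = "X interior_of {x \<in> topspace X. f x \<in> B'}"
    have "?I \<inter> Z = {}"
      using B(5) ZB interior_of_subset[of X "{x \<in> topspace X. f x \<in> B'}"] by (fastforce simp: disjnt_iff)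
    then have "?I \<inter> X closure_of Z = {}"
      by (simp add: openin_Int_closure_of_eq_empty)
    then have "?I \<subseteq> G"
      using interior_of_subset_topspace[of X "{x \<in> topspace X. f x \<in> B'}"] unfolding G_def by blast
    then have "X closure_of ?I \<subseteq> X closure_of G" by (rule closure_of_mono)
    moreover have "x \<in> {x \<in> topspace X. f x \<in> B'}" using x B(4) by simp
    ultimately show ?thesis
      using quasicontinuous_map_preimage_subset[OF f B(2)] by (meson subsetD)
  qed
  define h where "h x = (if x \<in> X closure_of G \<and> f x \<noteq> y then y else y')" for x
  have hG: "h x = y" if "x \<in> G" for x
    using that fy closure_of_subset[OF openin_subset[OF opG]] unfolding h_def G_def by auto
  have hZ: "h x = y'" if "x \<in> Z" for x
    using that ZG unfolding h_def by auto
  have "quasicontinuous_map X Y h"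
    unfolding quasicontinuous_map_def
  proof (intro conjI ballI allI impI)
    show "h \<in> topspace X \<rightarrow> topspace Y" using y by (auto simp: h_def)
    fix x V U assume x: "x \<in> topspace X" and H: "openin Y V \<and> h x \<in> V \<and> openin X U \<and> x \<in> U"
    show "\<exists>W. openin X W \<and> W \<noteq> {} \<and> W \<subseteq> U \<and> h ` W \<subseteq> V"
    proof (cases "x \<in> X closure_of G \<and> f x \<noteq> y")
      case True
      have "h ` (G \<inter> U) \<subseteq> V" using H True hG by (auto simp: h_def)
      moreover have "G \<inter> U \<noteq> {}" using True H by (auto simp: in_closure_of)
      moreover have "openin X (G \<inter> U)" using opG H by blast
      ultimately show ?thesis by (meson inf_le2)
    next
      case False
      then have "x \<in> X closure_of Z"
        using fy x closure_of_subset[OF openin_subset[OF opG]] by (auto simp: G_def)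
      moreover have "h ` (Z \<inter> U) \<subseteq> V" using H False hZ by (auto simp: h_def)
      moreover have "openin X (Z \<inter> U)" using opZ H by blast
      ultimately show ?thesis using H by (intro exI[of _ "Z \<inter> U"]) (auto simp: in_closure_of)
    qed
  qed
  moreover have "h x \<noteq> f x" if "x \<in> topspace X" for x
    using fy'[OF that] y by (auto simp: h_def)
  ultimately show ?thesis by blast
qed

section \<open>The topology of pointwise convergence\<close>

text \<open>
  Basic neighbourhoods of \<open>f\<close> restrict only finitely many coordinates.
\<close>
lemma in_closure_of_Q_pI:
  assumes f: "f \<in> topspace (Q_p X Y)" and A: "A \<subseteq> topspace (Q_p X Y)"
    and approx: "\<And>F V. finite F \<Longrightarrow> F \<subseteq> topspace X \<Longrightarrow> (\<And>x. x \<in> F \<Longrightarrow> openin Y (V x) \<and> f x \<in> V x)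
       \<Longrightarrow> \<exists>g\<in>A. \<forall>x\<in>F. g x \<in> V x"
  shows "f \<in> Q_p X Y closure_of A"
  unfolding in_closure_of
proof (intro conjI allI impI f)
  fix T assume T: "f \<in> T \<and> openin (Q_p X Y) T"
  then obtain S where S: "openin (product_topology (\<lambda>_. Y) (topspace X)) S"
    and TS: "T = S \<inter> {f. quasicontinuous_map X Y f}"
    by (auto simp: Q_p_def openin_subtopology)
  have "f \<in> S" using T TS by blast
  with S obtain V where V: "finite {x \<in> topspace X. V x \<noteq> topspace Y}"
    "\<forall>x \<in> topspace X. openin Y (V x)" "f \<in> Pi\<^sub>E (topspace X) V" "Pi\<^sub>E (topspace X) V \<subseteq> S"
    unfolding openin_product_topology_alt by auto
  obtain g where g: "g \<in> A" "\<forall>x \<in> {x \<in> topspace X. V x \<noteq> topspace Y}. g x \<in> V x"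
    using approx[OF V(1), of V] V(2,3) by (auto simp: PiE_iff)
  have gq: "g \<in> extensional (topspace X)" "quasicontinuous_map X Y g"
    using A g(1) by (auto simp: topspace_Q_p)
  have "g x \<in> V x" if "x \<in> topspace X" for x
    using g(2) that quasicontinuous_map_in_topspace[OF gq(2) that] by (cases "V x = topspace Y") simp_all
  then have "g \<in> Pi\<^sub>E (topspace X) V" using gq(1) by (simp add: PiE_iff)
  then have "g \<in> T" using gq(2) V(4) TS by blast
  with g(1) show "\<exists>y. y \<in> A \<and> y \<in> T" by blast
qed

lemma in_closure_of_Q_pD:
  assumes f: "f \<in> Q_p X Y closure_of A" and F: "finite F" "F \<subseteq> topspace X"
    and V: "\<And>x. x \<in> F \<Longrightarrow> openin Y (V x) \<and> f x \<in> V x"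
  obtains g where "g \<in> A" "\<And>x. x \<in> F \<Longrightarrow> g x \<in> V x"
proof -
  define N where "N = Pi\<^sub>E (topspace X) (\<lambda>x. if x \<in> F then V x else topspace Y)"
  have ft: "f \<in> topspace (Q_p X Y)" using f by (simp add: in_closure_of)
  have "openin (product_topology (\<lambda>_. Y) (topspace X)) N"
    unfolding N_def
    by (rule product_topology_basis) (use V F in \<open>auto intro: finite_subset[OF _ F(1)]\<close>)
  then have "openin (Q_p X Y) (N \<inter> {f. quasicontinuous_map X Y f})"
    unfolding Q_p_def openin_subtopology by blast
  with f have "f \<in> N \<inter> {f. quasicontinuous_map X Y f} \<longrightarrow>
      (\<exists>g. g \<in> A \<and> g \<in> N \<inter> {f. quasicontinuous_map X Y f})"
    unfolding in_closure_of by metis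
  moreover have "f \<in> N \<inter> {f. quasicontinuous_map X Y f}"
    using ft V quasicontinuous_map_in_topspace[of X Y f]
    by (simp add: N_def topspace_Q_p PiE_iff)
  ultimately obtain g where g: "g \<in> A" "g \<in> N" by blast
  have "g x \<in> V x" if "x \<in> F" for x
    using PiE_mem[OF g(2)[unfolded N_def] subsetD[OF F(2) that]] that by simp
  with g(1) show thesis by (rule that)
qed

lemma openin_mtopology_of_mball: "openin (mtopology_of m) (mball_of m x r)"
  by (simp add: mtopology_of_def mball_of_def Metric_space.openin_mball)

lemma centre_in_mball_of: "x \<in> mspace m \<Longrightarrow> r > 0 \<Longrightarrow> x \<in> mball_of m x r"
  by (metis in_mball_of mdist_zero)

lemma in_closure_of_Q_p_metric_iff:
  assumes A: "A \<subseteq> topspace (Q_p X (mtopology_of m))"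
  shows "f \<in> Q_p X (mtopology_of m) closure_of A \<longleftrightarrow>
     f \<in> topspace (Q_p X (mtopology_of m)) \<and>
     (\<forall>F e. finite F \<and> F \<subseteq> topspace X \<and> e > 0 \<longrightarrow> (\<exists>g\<in>A. \<forall>x\<in>F. mdist m (f x) (g x) < e))"
    (is "?L \<longleftrightarrow> ?R")
proof
  assume L: ?L
  then have ft: "f \<in> topspace (Q_p X (mtopology_of m))" by (simp add: in_closure_of)
  then have q: "quasicontinuous_map X (mtopology_of m) f" by (simp add: topspace_Q_p)
  have "\<exists>g\<in>A. \<forall>x\<in>F. mdist m (f x) (g x) < e" if F: "finite F" "F \<subseteq> topspace X" "e > 0" for F e
  proof -
    have "openin (mtopology_of m) (mball_of m (f x) e) \<and> f x \<in> mball_of m (f x) e" if "x \<in> F" for x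
      using quasicontinuous_map_in_topspace[OF q, of x] that F
      by (auto simp: openin_mtopology_of_mball intro!: centre_in_mball_of simp del: in_mball_of)
    from in_closure_of_Q_pD[OF L F(1,2), of "\<lambda>x. mball_of m (f x) e", OF this]
    obtain g where "g \<in> A" "\<And>x. x \<in> F \<Longrightarrow> g x \<in> mball_of m (f x) e" by blast
    then show ?thesis by (intro bexI[of _ g]) auto
  qed
  with ft show ?R by blast
next
  assume R: ?R
  show ?L
  proof (rule in_closure_of_Q_pI)
    show "f \<in> topspace (Q_p X (mtopology_of m))" using R by blast
    fix F V assume F: "finite F" "F \<subseteq> topspace X"
      and V: "\<And>x. x \<in> F \<Longrightarrow> openin (mtopology_of m) (V x) \<and> f x \<in> V x"
    have "\<exists>r. r > 0 \<and> mball_of m (f x) r \<subseteq> V x" if "x \<in> F" for x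
      using V[OF that] Metric_space.openin_mtopology[OF Metric_space_mspace_mdist, of m "V x"]
      by (auto simp: mtopology_of_def mball_of_def)
    then obtain r where r: "\<And>x. x \<in> F \<Longrightarrow> r x > 0 \<and> mball_of m (f x) (r x) \<subseteq> V x" by metis
    define e where "e = Min (insert 1 (r ` F))"
    have e: "e > 0" "\<And>x. x \<in> F \<Longrightarrow> e \<le> r x" unfolding e_def using F r by auto
    obtain g where g: "g \<in> A" "\<forall>x\<in>F. mdist m (f x) (g x) < e"
      using R F e(1) by blast
    have gq: "quasicontinuous_map X (mtopology_of m) g" and fq: "quasicontinuous_map X (mtopology_of m) f"
      using A g(1) R by (auto simp: topspace_Q_p)
    have "g x \<in> V x" if "x \<in> F" for x
    proof -
      have "g x \<in> mball_of m (f x) (r x)"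
        using g e(2)[OF that] that F quasicontinuous_map_in_topspace[OF gq, of x]
          quasicontinuous_map_in_topspace[OF fq, of x] by fastforce
      then show ?thesis using r[OF that] by blast
    qed
    then show "\<exists>g\<in>A. \<forall>x\<in>F. g x \<in> V x" using g(1) by blast
  qed (rule A)
qed

section \<open>The families of open sets with covering closures\<close>

text \<open>
  The covering condition is the case of singletons in the condition on finite sets.
\<close>
lemma K_OmegaI:
  assumes "\<And>U. U \<in> \<U> \<Longrightarrow> openin X U" "\<And>U. U \<in> \<U> \<Longrightarrow> X closure_of U \<noteq> topspace X"
    and fin: "\<And>F. finite F \<Longrightarrow> F \<subseteq> topspace X \<Longrightarrow> \<exists>U\<in>\<U>. F \<subseteq> X closure_of U"
  shows "\<U> \<in> K_Omega X"
proof -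
  have "\<exists>U\<in>\<U>. x \<in> X closure_of U" if "x \<in> topspace X" for x
    using fin[of "{x}"] that by auto
  moreover have "(\<Union>U\<in>\<U>. X closure_of U) \<subseteq> topspace X"
    by (intro UN_least closure_of_subset_topspace)
  ultimately have "topspace X = (\<Union>U\<in>\<U>. X closure_of U)"
    by (intro equalityI subsetI UN_iff[THEN iffD2]) (simp_all add: subset_iff)
  then show ?thesis using assms unfolding K_Omega_def mem_Collect_eq by (intro conjI ballI allI impI) simp_all
qed

lemma K_OmegaD:
  assumes "\<U> \<in> K_Omega X"
  shows "U \<in> \<U> \<Longrightarrow> openin X U" "U \<in> \<U> \<Longrightarrow> X closure_of U \<noteq> topspace X"
    and "finite F \<Longrightarrow> F \<subseteq> topspace X \<Longrightarrow> \<exists>U\<in>\<U>. F \<subseteq> X closure_of U"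
proof -
  have "(\<forall>U\<in>\<U>. openin X U) \<and> (\<forall>U\<in>\<U>. X closure_of U \<noteq> topspace X) \<and>
    (\<forall>F. finite F \<and> F \<subseteq> topspace X \<longrightarrow> (\<exists>U\<in>\<U>. F \<subseteq> X closure_of U))"
    using assms unfolding K_Omega_def mem_Collect_eq by (elim conjE) (intro conjI; assumption)
  then show "U \<in> \<U> \<Longrightarrow> openin X U" "U \<in> \<U> \<Longrightarrow> X closure_of U \<noteq> topspace X"
    "finite F \<Longrightarrow> F \<subseteq> topspace X \<Longrightarrow> \<exists>U\<in>\<U>. F \<subseteq> X closure_of U"
    by simp_all
qed

lemma S_1D:
  assumes "S_1 \<A> \<B>" "\<And>n. \<U> n \<in> \<A>"
  shows "\<exists>u :: nat \<Rightarrow> 'a set. (\<forall>n. u n \<in> \<U> n) \<and> range u \<in> \<B>"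
  using assms by (simp add: S_1_def)

text \<open>
  Adding to \<open>F\<close> a point missed by the closure of each of the first \<open>N\<close> sets excludes the indices
  below \<open>N\<close>.
\<close>
lemma range_in_K_Omega_infinitely_often:
  fixes u :: "nat \<Rightarrow> 'a set"
  assumes u: "range u \<in> K_Omega X" and F: "finite F" "F \<subseteq> topspace X"
  shows "\<exists>n\<ge>N. F \<subseteq> X closure_of u n"
proof -
  have "\<exists>p. p \<in> topspace X \<and> p \<notin> X closure_of u n" for n
    using K_OmegaD(2)[OF u, of "u n"] closure_of_subset_topspace[of X "u n"] by auto
  then obtain p where p: "\<And>n. p n \<in> topspace X" "\<And>n. p n \<notin> X closure_of u n" by metis
  have "finite (F \<union> p ` {..<N})" "F \<union> p ` {..<N} \<subseteq> topspace X" using F p by auto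
  then obtain n where n: "F \<union> p ` {..<N} \<subseteq> X closure_of u n"
    using K_OmegaD(3)[OF u] by (metis rangeE)
  have "\<not> n < N" using n p(2)[of n] by blast
  then show ?thesis using n by (intro exI[of _ n]) auto
qed

section \<open>From strong fan tightness to the selection principle\<close>

text \<open>
  The points of \<open>F\<close> may lie on the boundary of \<open>U\<close>, where \<open>f\<close> may be approximated only from
  outside \<open>U\<close>; so \<open>g\<close> is not taken from \<open>f\<close> near \<open>x \<in> F\<close> but is constantly \<open>f x\<close> on the closure
  of the part of \<open>U\<close> near \<open>x\<close>.
\<close>
lemma quasicontinuous_map_interpolate:
  assumes X: "metrizable_space X" and U: "openin X U"
    and f: "f \<in> topspace X \<rightarrow> topspace Y" and h: "quasicontinuous_map X Y h"
    and F: "finite F" "F \<subseteq> X closure_of U"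
  shows "\<exists>g. quasicontinuous_map X Y g \<and> (\<forall>x\<in>F. g x = f x) \<and>
             (\<forall>x \<in> topspace X - X closure_of U. g x = h x)"
  using F
proof (induction F rule: finite_induct)
  case empty
  then show ?case using h by blast
next
  case (insert x F)
  then obtain g where g: "quasicontinuous_map X Y g" "\<forall>z\<in>F. g z = f z"
    "\<forall>z \<in> topspace X - X closure_of U. g z = h z" by auto
  have xX: "x \<in> topspace X" and FX: "F \<subseteq> topspace X"
    using insert.prems closure_of_subset_topspace[of X U] by auto
  have "closedin X F"
    using X FX insert.hyps(1) metrizable_imp_t1_space t1_space_closedin_finite by blast
  moreover have "x \<in> topspace X - F" using xX insert.hyps by auto
  ultimately obtain B N where B: "openin X B" "openin X N" "x \<in> B" "F \<subseteq> N" "disjnt B N"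
    using metrizable_imp_regular_space[OF X] unfolding regular_space_def by metis
  have BN: "X closure_of (U \<inter> B) \<inter> N = {}"
    using B openin_Int_closure_of_eq_empty[of X N "U \<inter> B"] by (auto simp: disjnt_iff)
  have xcl: "x \<in> X closure_of (U \<inter> B)"
    using insert.prems B(3) openin_Int_closure_of_subset[OF B(1), of U] by (auto simp: Int_commute)
  let ?g = "\<lambda>z. if z \<in> X closure_of (U \<inter> B) then f x else g z"
  have "quasicontinuous_map X Y ?g"
    using quasicontinuous_map_patch[OF g(1), of "U \<inter> B" "f x"] U B(1) f xX by auto
  moreover have "X closure_of (U \<inter> B) \<subseteq> X closure_of U" by (simp add: closure_of_mono)
  ultimately show ?case
    using g xcl BN B(4) by (intro exI[of _ ?g]) auto
qed

text \<open>
  A member of \<open>A n\<close> below is tied to \<open>h\<close> outside the closure of some \<open>U \<in> \<U> n\<close>, and \<open>h\<close> avoids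
  \<open>f\<close>; so every point at which it comes near \<open>f\<close>, and hence differs from \<open>h\<close>, lies in the closure
  of \<open>U\<close>.
\<close>
lemma strong_fan_tightness_imp_S_1:
  assumes X: "metrizable_space X" and Y: "Hausdorff_space Y"
    and y: "y \<in> topspace Y" "y' \<in> topspace Y" "y \<noteq> y'"
    and f: "f \<in> topspace (Q_p X Y)" and tight: "countable_strong_fan_tightness_at (Q_p X Y) f"
  shows "S_1 (K_Omega X) (K_Omega X)"
  unfolding S_1_def
proof (intro allI impI)
  fix \<U> :: "nat \<Rightarrow> 'a set set" assume \<U>: "\<forall>n. \<U> n \<in> K_Omega X"
  have fq: "quasicontinuous_map X Y f" using f by (simp add: topspace_Q_p)
  obtain h where h: "quasicontinuous_map X Y h" "\<forall>x \<in> topspace X. h x \<noteq> f x"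
    using quasicontinuous_map_nowhere_equal[OF fq Y y] by auto
  define A where "A n = {g \<in> topspace (Q_p X Y). \<exists>U \<in> \<U> n. \<forall>x \<in> topspace X - X closure_of U. g x = h x}" for n
  have clA: "f \<in> Q_p X Y closure_of A n" for n
  proof (rule in_closure_of_Q_pI[OF f])
    show "A n \<subseteq> topspace (Q_p X Y)" by (auto simp: A_def)
    fix F V assume F: "finite F" "F \<subseteq> topspace X" and V: "\<And>x. x \<in> F \<Longrightarrow> openin Y (V x) \<and> f x \<in> V x"
    obtain U where U: "U \<in> \<U> n" "F \<subseteq> X closure_of U" "openin X U"
      using K_OmegaD(1,3)[OF \<U>[rule_format, of n]] F by metis
    have "f \<in> topspace X \<rightarrow> topspace Y" using fq by (simp add: quasicontinuous_map_def)
    then obtain g where g: "quasicontinuous_map X Y g" "\<forall>x\<in>F. g x = f x"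
      "\<forall>x \<in> topspace X - X closure_of U. g x = h x"
      using quasicontinuous_map_interpolate[OF X U(3) _ h(1) F(1) U(2), of f] by auto
    have "quasicontinuous_map X Y (restrict g (topspace X))"
      by (rule quasicontinuous_map_cong[OF _ g(1)]) auto
    then have "restrict g (topspace X) \<in> A n"
      using U g by (auto simp: A_def topspace_Q_p)
    then show "\<exists>g\<in>A n. \<forall>x\<in>F. g x \<in> V x"
      using g(2) F V by (intro bexI[of _ "restrict g (topspace X)"]) auto
  qed
  obtain a where a: "\<And>n. a n \<in> A n" "f \<in> Q_p X Y closure_of (range a)"
  proof -
    have "\<forall>n. A n \<subseteq> topspace (Q_p X Y)" by (auto simp: A_def)
    with clA tight have "\<exists>a. (\<forall>n. a n \<in> A n) \<and> f \<in> Q_p X Y closure_of (range a)"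
      by (simp add: countable_strong_fan_tightness_at_def)
    then show ?thesis using that by auto
  qed
  have "\<exists>U. U \<in> \<U> n \<and> (\<forall>x \<in> topspace X - X closure_of U. a n x = h x)" for n
    using a(1)[of n] unfolding A_def by blast
  then obtain u where u: "\<And>n. u n \<in> \<U> n" "\<And>n x. x \<in> topspace X - X closure_of u n \<Longrightarrow> a n x = h x"
    by metis
  have "range u \<in> K_Omega X"
  proof (rule K_OmegaI)
    fix F assume F: "finite F" "F \<subseteq> topspace X"
    have "openin Y (topspace Y - {h x}) \<and> f x \<in> topspace Y - {h x}" if "x \<in> F" for x
    proof -
      have x: "x \<in> topspace X" using that F by blast
      then have "closedin Y {h x}"
        using closedin_Hausdorff_singleton[OF Y quasicontinuous_map_in_topspace[OF h(1)]] by blast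
      then show ?thesis
        using h(2) x quasicontinuous_map_in_topspace[OF fq x] by (auto simp: openin_diff)
    qed
    from in_closure_of_Q_pD[OF a(2) F, of "\<lambda>x. topspace Y - {h x}", OF this]
    obtain g where g: "g \<in> range a" "\<And>x. x \<in> F \<Longrightarrow> g x \<in> topspace Y - {h x}" by metis
    then obtain n where "g = a n" by blast
    with g(2) have "F \<subseteq> X closure_of u n" using u(2)[of _ n] F by blast
    then show "\<exists>U\<in>range u. F \<subseteq> X closure_of U" by blast
  qed (use u(1) K_OmegaD(1,2)[OF \<U>[rule_format]] in blast)+
  with u(1) show "\<exists>u. (\<forall>n. u n \<in> \<U> n) \<and> range u \<in> K_Omega X" by blast
qed

section \<open>From the selection principle to strong fan tightness\<close>

text \<open>
  The set \<open>U\<close> is a union of small balls inside \<open>I\<close> that converge to \<open>x\<close>: away from \<open>x\<close> only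
  finitely many of them matter, so that nothing but \<open>x\<close> is added when passing to the closure.
\<close>
lemma metrizable_open_closure_between_point:
  assumes X: "metrizable_space X" and I: "openin X I" and x: "x \<in> X closure_of I"
  obtains U where "openin X U" "x \<in> X closure_of U" "X closure_of U \<subseteq> insert x I"
proof -
  obtain M d where "Metric_space M d" and X: "X = Metric_space.mtopology M d"
    using X unfolding metrizable_space_def by blast
  then interpret Metric_space M d by simp
  have xM: "x \<in> M" using x X by (auto simp: in_closure_of)
  have "\<exists>y r. 0 < r \<and> y \<in> M \<and> mcball y r \<subseteq> I \<inter> mball x (inverse (Suc k))" for k
  proof -
    have op: "openin mtopology (I \<inter> mball x (inverse (Suc k)))" using I unfolding X by (intro openin_Int openin_mball)
    have "inverse (real (Suc k)) > 0" by simp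
    then obtain y where y: "y \<in> I \<inter> mball x (inverse (Suc k))"
      using x unfolding X metric_closure_of by blast
    then have "y \<in> M" by auto
    with y op show ?thesis unfolding openin_mtopology_mcball by blast
  qed
  then obtain y r where yr: "\<And>k. 0 < r k" "\<And>k. y k \<in> M" "\<And>k. mcball (y k) (r k) \<subseteq> I \<inter> mball x (inverse (Suc k))"
    by metis
  define U where "U = (\<Union>k. mball (y k) (r k))"
  have "openin X U" unfolding U_def X by auto
  moreover have "x \<in> X closure_of U"
    unfolding X metric_closure_of
  proof (intro CollectI conjI allI impI xM)
    fix e :: real assume "e > 0"
    then obtain k where k: "inverse (Suc k) < e" using reals_Archimedean by blast
    have "y k \<in> U" unfolding U_def using yr by (intro UN_I[of k]) auto
    moreover have "y k \<in> mball x (inverse (Suc k))"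
      using yr(1)[of k] yr(2,3)[of k] by (meson Int_iff centre_in_mcball_iff less_imp_le subsetD)
    ultimately show "\<exists>y\<in>U. y \<in> mball x e" using k by (intro bexI[of _ "y k"]) auto
  qed
  moreover have "z \<in> insert x I" if z: "z \<in> X closure_of U" for z
  proof (rule ccontr)
    assume n: "z \<notin> insert x I"
    have zM: "z \<in> M" using z X by (auto simp: in_closure_of)
    then have "d x z > 0" using n xM by auto
    then obtain K where K: "inverse (Suc K) < d x z" using reals_Archimedean by blast
    let ?C = "(\<Union>k\<in>{..<K}. mcball (y k) (r k)) \<union> mcball x (inverse (Suc K))"
    have "closedin X ?C"
      unfolding X by (intro closedin_Un closedin_Union) auto
    moreover have "U \<subseteq> ?C"
    proof
      fix w assume "w \<in> U"
      then obtain k where w: "w \<in> mball (y k) (r k)" unfolding U_def by blast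
      show "w \<in> ?C"
      proof (cases "k < K")
        case True
        then show ?thesis using w mball_subset_mcball by blast
      next
        case False
        then have "inverse (real (Suc k)) \<le> inverse (Suc K)" by (simp add: le_imp_inverse_le)
        moreover have "w \<in> mball x (inverse (Suc k))"
          using w yr(3)[of k] mball_subset_mcball by blast
        ultimately have "w \<in> mcball x (inverse (Suc K))" unfolding in_mball in_mcball by linarith
        then show ?thesis by blast
      qed
    qed
    ultimately have "z \<in> ?C" using z closure_of_minimal[of U ?C X] by blast
    moreover have "z \<notin> mcball x (inverse (Suc K))" using K by auto
    ultimately show False using n yr(3) by blast
  qed
  ultimately show thesis using that by blast
qed

lemma metrizable_open_closure_between:
  assumes X: "metrizable_space X" and F: "finite F" "F \<subseteq> T" "F \<subseteq> X closure_of (X interior_of T)"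
  shows "\<exists>U. openin X U \<and> F \<subseteq> X closure_of U \<and> X closure_of U \<subseteq> T"
  using F
proof (induction F rule: finite_induct)
  case empty
  then show ?case by (intro exI[of _ "{}"]) auto
next
  case (insert x F)
  then obtain U where U: "openin X U" "F \<subseteq> X closure_of U" "X closure_of U \<subseteq> T" by auto
  obtain V where V: "openin X V" "x \<in> X closure_of V" "X closure_of V \<subseteq> insert x (X interior_of T)"
    using metrizable_open_closure_between_point[OF X openin_interior_of, of x] insert.prems by blast
  have "X interior_of T \<subseteq> T" by (rule interior_of_subset)
  then have "openin X (U \<union> V) \<and> insert x F \<subseteq> X closure_of (U \<union> V) \<and> X closure_of (U \<union> V) \<subseteq> T"
    using U V insert.prems by auto
  then show ?case by blast
qed

text \<open>
  Infinity of \<open>X\<close> provides a point outside any given finite set; keeping the closure of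
  \<open>U\<close> away from that point makes \<open>U\<close> non-dense.
\<close>
lemma K_Omega_closures_within:
  assumes X: "metrizable_space X" and inf: "infinite (topspace X)"
    and fin: "\<And>F. finite F \<Longrightarrow> F \<subseteq> topspace X \<Longrightarrow>
       \<exists>T\<in>\<T>. F \<subseteq> T \<and> F \<subseteq> X closure_of (X interior_of T)"
  shows "{U. openin X U \<and> X closure_of U \<noteq> topspace X \<and> (\<exists>T\<in>\<T>. X closure_of U \<subseteq> T)} \<in> K_Omega X"
proof (rule K_OmegaI)
  fix F assume F: "finite F" "F \<subseteq> topspace X"
  then obtain T where T: "T \<in> \<T>" "F \<subseteq> T" "F \<subseteq> X closure_of (X interior_of T)"
    using fin by blast
  \<comment> \<open>The closure of the set to be constructed will avoid \<open>p\<close>.\<close>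
  obtain p where p: "p \<in> topspace X" "p \<notin> F"
    using F inf by (meson finite_subset subsetI)
  have clp: "closedin X {p}"
    using metrizable_imp_t1_space[OF X] p(1) by (simp add: t1_space_closedin_singleton)
  have "F \<subseteq> X closure_of (X interior_of (T - {p}))"
  proof
    fix x assume x: "x \<in> F"
    have "x \<in> X closure_of (X interior_of T)" using T(3) x by (rule subsetD)
    moreover have "x \<in> topspace X" using F(2) x by (rule subsetD)
    ultimately have "x \<in> (topspace X - {p}) \<inter> X closure_of (X interior_of T)"
      using x p(2) by auto
    also have "\<dots> \<subseteq> X closure_of ((topspace X - {p}) \<inter> X interior_of T)"
      using clp by (intro openin_Int_closure_of_subset) (simp add: openin_diff)
    also have "\<dots> \<subseteq> X closure_of (X interior_of (T - {p}))"
    proof (intro closure_of_mono interior_of_maximal)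
      show "(topspace X - {p}) \<inter> X interior_of T \<subseteq> T - {p}"
        using interior_of_subset[of X T] by blast
      show "openin X ((topspace X - {p}) \<inter> X interior_of T)"
        using clp by (simp add: openin_Int openin_diff)
    qed
    finally show "x \<in> X closure_of (X interior_of (T - {p}))" .
  qed
  then obtain U where "openin X U" "F \<subseteq> X closure_of U" "X closure_of U \<subseteq> T - {p}"
    using metrizable_open_closure_between[OF X F(1), of "T - {p}"] p(2) T by blast
  then show "\<exists>U\<in>{U. openin X U \<and> X closure_of U \<noteq> topspace X \<and> (\<exists>T\<in>\<T>. X closure_of U \<subseteq> T)}. F \<subseteq> X closure_of U"
    using T(1) p(1) by blast
qed simp_all

text \<open>
  As \<open>D\<close> is nowhere dense, every point can be approached through the complement of \<open>D\<close>.  Hence,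
  when \<open>X\<close> is infinite, the non-dense open sets whose closure meets \<open>D\<close> in a finite set form a family
  in \<open>\<K>\<^sub>\<Omega>\<close>, and countably many of these closures cover \<open>X\<close>.
\<close>
lemma S_1_imp_closed_nowhere_dense_countable:
  assumes X: "metrizable_space X" and S: "S_1 (K_Omega X) (K_Omega X)"
    and D: "closedin X D" "X interior_of D = {}"
  shows "countable D"
proof (cases "finite (topspace X)")
  case True
  then show ?thesis by (rule countable_finite[OF finite_subset[OF closedin_subset[OF D(1)]]])
next
  case False
  define \<T> where "\<T> = {T. finite (D \<inter> T)}"
  let ?\<U> = "{U. openin X U \<and> X closure_of U \<noteq> topspace X \<and> (\<exists>T\<in>\<T>. X closure_of U \<subseteq> T)}"
  have K: "?\<U> \<in> K_Omega X"
  proof (rule K_Omega_closures_within[OF X False])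
    fix F assume F: "finite F" "F \<subseteq> topspace X"
    \<comment> \<open>Only the points of \<open>F\<close> may belong to \<open>D\<close>.\<close>
    let ?T = "(topspace X - D) \<union> F"
    have "topspace X - D \<subseteq> X interior_of ?T"
      using D(1) by (intro interior_of_maximal) (simp_all add: openin_diff)
    moreover have "X closure_of (topspace X - D) = topspace X"
      using D(2) by (simp add: closure_of_complement)
    ultimately have "F \<subseteq> X closure_of (X interior_of ?T)"
      using F closure_of_mono[of "topspace X - D" "X interior_of ?T" X] by simp
    moreover have "?T \<in> \<T>" using F(1) by (auto simp: \<T>_def Int_Un_distrib)
    ultimately show "\<exists>T\<in>\<T>. F \<subseteq> T \<and> F \<subseteq> X closure_of (X interior_of T)" by blast
  qed
  obtain u :: "nat \<Rightarrow> 'a set" where u: "\<forall>n. u n \<in> ?\<U>" "range u \<in> K_Omega X"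
    using S_1D[OF S, of "\<lambda>_. ?\<U>", OF K] by (elim exE conjE)
  have "D \<subseteq> (\<Union>n. D \<inter> X closure_of u n)"
  proof
    fix x assume x: "x \<in> D"
    then have "{x} \<subseteq> topspace X" using closedin_subset[OF D(1)] by blast
    then obtain n where "{x} \<subseteq> X closure_of u n" using K_OmegaD(3)[OF u(2), of "{x}"] by blast
    then show "x \<in> (\<Union>n. D \<inter> X closure_of u n)" using x by blast
  qed
  moreover have "countable (D \<inter> X closure_of u n)" for n
  proof -
    obtain T where "T \<in> \<T>" "X closure_of u n \<subseteq> T" using u(1) by blast
    then show ?thesis
      unfolding \<T>_def by (intro countable_finite finite_subset[of "D \<inter> X closure_of u n" "D \<inter> T"]) auto
  qed
  then have "countable (\<Union>n. D \<inter> X closure_of u n)" by (intro countable_UN countableI_type)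
  ultimately show ?thesis by (rule countable_subset)
qed

lemma metrizable_shrinking_neighbourhoods:
  assumes X: "metrizable_space X" and D: "closedin X D"
  shows "\<exists>G :: nat \<Rightarrow> 'a set. (\<forall>n. openin X (G n) \<and> D \<subseteq> G n) \<and>
     (\<forall>x \<in> topspace X - D. \<exists>N. \<forall>n\<ge>N. x \<notin> G n)"
proof -
  obtain M d where "Metric_space M d" and X: "X = Metric_space.mtopology M d"
    using X unfolding metrizable_space_def by blast
  then interpret Metric_space M d by simp
  define G where "G n = (\<Union>y\<in>D. mball y (inverse (Suc n)))" for n
  show ?thesis
  proof (intro exI[of _ G] conjI allI ballI)
    show "openin X (G n)" for n unfolding G_def X by auto
    show "D \<subseteq> G n" for n
      using closedin_subset[OF D] X by (fastforce simp: G_def)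
    fix x assume "x \<in> topspace X - D"
    moreover have "openin X (topspace X - D)" using D by (simp add: openin_diff)
    ultimately obtain r where r: "r > 0" "mball x r \<subseteq> topspace X - D"
      unfolding X openin_mtopology by blast
    then obtain N where N: "inverse (Suc N) < r" using reals_Archimedean by blast
    have "x \<notin> G n" if "n \<ge> N" for n
    proof
      assume "x \<in> G n"
      then obtain y where y: "y \<in> D" "x \<in> mball y (inverse (Suc n))" by (auto simp: G_def)
      have "inverse (real (Suc n)) \<le> inverse (Suc N)" using that by (simp add: le_imp_inverse_le)
      then have "y \<in> mball x r"
        using y(2) N unfolding in_mball by (metis commute less_le_trans less_trans)
      then show False using r y by blast
    qed
    then show "\<exists>N. \<forall>n\<ge>N. x \<notin> G n" by blast
  qed
qed

text \<open>
  The distance \<open>e\<close> has to be attained in every neighbourhood, instead of bounding a supremum of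
  distances: the complement is then the union of the open sets on which \<open>f\<close> varies by less
  than \<open>e\<close>.
\<close>
definition oscillation_ge :: "'a topology \<Rightarrow> 'b metric \<Rightarrow> ('a \<Rightarrow> 'b) \<Rightarrow> real \<Rightarrow> 'a set" where
  "oscillation_ge X m f e =
     {x \<in> topspace X. \<forall>U. openin X U \<and> x \<in> U \<longrightarrow> (\<exists>y\<in>U. \<exists>z\<in>U. mdist m (f y) (f z) \<ge> e)}"

lemma closedin_oscillation_ge: "closedin X (oscillation_ge X m f e)"
proof -
  have "topspace X - oscillation_ge X m f e =
     \<Union>{U. openin X U \<and> (\<forall>y\<in>U. \<forall>z\<in>U. mdist m (f y) (f z) < e)}"
  proof (intro equalityI subsetI)
    fix x assume "x \<in> topspace X - oscillation_ge X m f e"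
    then show "x \<in> \<Union>{U. openin X U \<and> (\<forall>y\<in>U. \<forall>z\<in>U. mdist m (f y) (f z) < e)}"
      by (force simp: oscillation_ge_def not_le)
  next
    fix x assume "x \<in> \<Union>{U. openin X U \<and> (\<forall>y\<in>U. \<forall>z\<in>U. mdist m (f y) (f z) < e)}"
    then obtain U where U: "openin X U" "x \<in> U" "\<forall>y\<in>U. \<forall>z\<in>U. mdist m (f y) (f z) < e" by blast
    then show "x \<in> topspace X - oscillation_ge X m f e"
      using openin_subset[OF U(1)] by (force simp: oscillation_ge_def not_le)
  qed
  moreover have "openin X (\<Union>{U. openin X U \<and> (\<forall>y\<in>U. \<forall>z\<in>U. mdist m (f y) (f z) < e)})"
    by (rule openin_Union) blast
  ultimately show ?thesis by (simp add: closedin_def oscillation_ge_def)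
qed

text \<open>
  Inside any nonempty open set, quasicontinuity finds a nonempty open set whose image lies in a ball
  of radius \<open>e/2\<close>; on it \<open>f\<close> varies by less than \<open>e\<close>.
\<close>
lemma interior_of_oscillation_ge:
  assumes f: "quasicontinuous_map X (mtopology_of m) f" and e: "e > 0"
  shows "X interior_of (oscillation_ge X m f e) = {}"
proof (rule ccontr)
  let ?I = "X interior_of (oscillation_ge X m f e)"
  assume "?I \<noteq> {}"
  then obtain x where x: "x \<in> ?I" by blast
  then have xX: "x \<in> topspace X" using interior_of_subset_topspace[of X] by blast
  have fx: "f x \<in> mspace m" using quasicontinuous_map_in_topspace[OF f xX] by simp
  have "f x \<in> mball_of m (f x) (e/2)" using fx e by (intro centre_in_mball_of) auto
  then obtain W where W: "openin X W" "W \<noteq> {}" "W \<subseteq> ?I" "f ` W \<subseteq> mball_of m (f x) (e/2)"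
    using quasicontinuous_mapD[OF f xX openin_mtopology_of_mball _ openin_interior_of x] by metis
  have "mdist m (f y) (f z) < e" if "y \<in> W" "z \<in> W" for y z
  proof -
    have "f y \<in> mball_of m (f x) (e/2)" "f z \<in> mball_of m (f x) (e/2)" using that W by auto
    then show ?thesis
      using mdist_triangle[of "f y" m "f x" "f z"] by (auto simp: mdist_commute)
  qed
  moreover obtain w where "w \<in> W" using W(2) by blast
  moreover have "w \<in> oscillation_ge X m f e"
    using \<open>w \<in> W\<close> W(3) interior_of_subset[of X "oscillation_ge X m f e"] by auto
  ultimately show False using W(1) by (force simp: oscillation_ge_def)
qed

text \<open>
  This is the heart of the argument.  Off the set \<open>D\<close> of large oscillation, \<open>f\<close> is nearly constant
  on a neighbourhood of \<open>x\<close>, so a quasicontinuous \<open>g\<close> with \<open>g x\<close> near \<open>f x\<close> is near \<open>f\<close> on open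
  sets arbitrarily close to \<open>x\<close>; this costs the factor \<open>3\<close>.  The countable set \<open>D\<close> is handled
  through the finite sets \<open>E n\<close> that exhaust it, on which closeness is imposed directly, and through
  neighbourhoods \<open>G n\<close> shrinking to \<open>D\<close>, into which the closure of the selected open set may
  extend even where \<open>g\<close> is far from \<open>f\<close>.
\<close>
lemma S_1_imp_uniform_selection:
  fixes X :: "'a topology" and m :: "'b metric"
  assumes X: "metrizable_space X" and S: "S_1 (K_Omega X) (K_Omega X)"
    and f: "quasicontinuous_map X (mtopology_of m) f" and e: "e > 0"
    and A: "\<And>n g. g \<in> A n \<Longrightarrow> quasicontinuous_map X (mtopology_of m) g"
    and approx: "\<And>n F. finite F \<Longrightarrow> F \<subseteq> topspace X \<Longrightarrow> \<exists>g\<in>A n. \<forall>x\<in>F. mdist m (f x) (g x) < e"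
  shows "\<exists>a :: nat \<Rightarrow> 'a \<Rightarrow> 'b. (\<forall>n. a n \<in> A n) \<and>
     (\<forall>F. finite F \<and> F \<subseteq> topspace X \<longrightarrow> (\<exists>n. \<forall>x\<in>F. mdist m (f x) (a n x) < 3 * e))"
proof (cases "finite (topspace X)")
  case True
  then have "\<forall>n. \<exists>g. g \<in> A n \<and> (\<forall>x\<in>topspace X. mdist m (f x) (g x) < e)" using approx by blast
  then obtain a where a: "\<And>n. a n \<in> A n" "\<And>n x. x \<in> topspace X \<Longrightarrow> mdist m (f x) (a n x) < e" by metis
  have "mdist m (f x) (a n x) < 3 * e" if "x \<in> topspace X" for n x
    using a(2)[OF that, of n] e by linarith
  then show ?thesis using a(1) by (intro exI[of _ a]) blast
next
  case False
  define D where "D = oscillation_ge X m f e"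
  have D: "closedin X D" "X interior_of D = {}"
    unfolding D_def by (rule closedin_oscillation_ge, rule interior_of_oscillation_ge[OF f e])
  have DX: "D \<subseteq> topspace X" using closedin_subset[OF D(1)] .
  have cD: "countable D" using S_1_imp_closed_nowhere_dense_countable[OF X S D] .
  define E where "E n = {x \<in> D. to_nat_on D x < n}" for n
  have finE: "finite (E n)" for n
  proof (rule finite_imageD)
    show "finite (to_nat_on D ` E n)" by (rule finite_subset[of _ "{..<n}"]) (auto simp: E_def)
    show "inj_on (to_nat_on D) (E n)"
      by (rule inj_on_subset[OF inj_on_to_nat_on[OF cD]]) (auto simp: E_def)
  qed
  obtain G :: "nat \<Rightarrow> 'a set" where G': "\<forall>n. openin X (G n) \<and> D \<subseteq> G n"
    "\<forall>x \<in> topspace X - D. \<exists>N. \<forall>n\<ge>N. x \<notin> G n"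
    using metrizable_shrinking_neighbourhoods[OF X D(1)] by (elim exE conjE)
  have G: "openin X (G n)" "D \<subseteq> G n" for n using G'(1) by simp_all
  define T where "T n g = {x \<in> topspace X. mdist m (f x) (g x) < 3 * e} \<union> G n" for n g
  define \<T> where "\<T> n = T n ` {g \<in> A n. \<forall>x\<in>E n. mdist m (f x) (g x) < e}" for n
  let ?\<U> = "\<lambda>n. {U. openin X U \<and> X closure_of U \<noteq> topspace X \<and> (\<exists>T\<in>\<T> n. X closure_of U \<subseteq> T)}"
  have K: "?\<U> n \<in> K_Omega X" for n
  proof (rule K_Omega_closures_within[OF X False])
    fix F assume F: "finite F" "F \<subseteq> topspace X"
    have "finite (F \<union> E n)" "F \<union> E n \<subseteq> topspace X" using F finE[of n] DX by (auto simp: E_def)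
    from approx[OF this] obtain g where g: "g \<in> A n" "\<And>x. x \<in> F \<union> E n \<Longrightarrow> mdist m (f x) (g x) < e"
      by blast
    have gq: "quasicontinuous_map X (mtopology_of m) g" using A g(1) .
    have "x \<in> X closure_of (X interior_of (T n g))" if x: "x \<in> F" for x
    proof (cases "x \<in> D")
      case True
      have "G n \<subseteq> X interior_of (T n g)" using G(1) by (intro interior_of_maximal) (auto simp: T_def)
      then have "x \<in> X interior_of (T n g)" using True G(2) by blast
      then show ?thesis
        using closure_of_subset[OF interior_of_subset_topspace[of X "T n g"]] by (rule subsetD[rotated])
    next
      case xD: False
      have xX: "x \<in> topspace X" using x F by blast
      then obtain N where N: "openin X N" "x \<in> N" "\<And>y z. y \<in> N \<Longrightarrow> z \<in> N \<Longrightarrow> mdist m (f y) (f z) < e"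
        using xD unfolding D_def oscillation_ge_def by (fastforce simp: not_le)
      have "\<exists>y. y \<in> X interior_of (T n g) \<and> y \<in> P" if P: "x \<in> P" "openin X P" for P
      proof -
        have "openin (mtopology_of m) (mball_of m (g x) e)" "g x \<in> mball_of m (g x) e"
          using quasicontinuous_map_in_topspace[OF gq xX] e
          by (simp_all add: openin_mtopology_of_mball centre_in_mball_of del: in_mball_of)
        then obtain W where W: "openin X W" "W \<noteq> {}" "W \<subseteq> N \<inter> P" "g ` W \<subseteq> mball_of m (g x) e"
          using quasicontinuous_mapD[OF gq xX, of "mball_of m (g x) e" "N \<inter> P"] N P by blast
        have "W \<subseteq> T n g"
        proof
          fix w assume w: "w \<in> W"
          then have wX: "w \<in> topspace X" using openin_subset[OF W(1)] by blast
          have sp: "f w \<in> mspace m" "f x \<in> mspace m" "g x \<in> mspace m" "g w \<in> mspace m"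
            using quasicontinuous_map_in_topspace[OF f] quasicontinuous_map_in_topspace[OF gq] wX xX
            by auto
          have "mdist m (f w) (f x) < e" "mdist m (f x) (g x) < e" "mdist m (g x) (g w) < e"
            using N w W g(2) x by auto
          then have "mdist m (f w) (g w) < 3 * e"
            using mdist_triangle[of "f w" m "f x" "g w"] mdist_triangle[of "f x" m "g x" "g w"] sp
            by linarith
          then show "w \<in> T n g" using wX by (simp add: T_def)
        qed
        then have "W \<subseteq> X interior_of (T n g)" using W(1) by (rule interior_of_maximal)
        then show ?thesis using W by blast
      qed
      then show ?thesis using xX by (auto simp: in_closure_of)
    qed
    moreover have "F \<subseteq> T n g"
      using g(2) F e by (force simp: T_def)
    moreover have "T n g \<in> \<T> n" using g by (auto simp: \<T>_def)
    ultimately show "\<exists>T\<in>\<T> n. F \<subseteq> T \<and> F \<subseteq> X closure_of (X interior_of T)" by blast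
  qed
  obtain u where u: "\<forall>n. u n \<in> ?\<U> n" "range u \<in> K_Omega X"
    using S_1D[OF S, of ?\<U>, OF K] by (elim exE conjE)
  have "\<exists>g. g \<in> A n \<and> (\<forall>x\<in>E n. mdist m (f x) (g x) < e) \<and> X closure_of u n \<subseteq> T n g" for n
  proof -
    obtain T' where "T' \<in> \<T> n" "X closure_of u n \<subseteq> T'" using u(1) by blast
    then show ?thesis unfolding \<T>_def by blast
  qed
  then obtain a where a: "\<And>n. a n \<in> A n" "\<And>n x. x \<in> E n \<Longrightarrow> mdist m (f x) (a n x) < e"
    "\<And>n. X closure_of u n \<subseteq> T n (a n)" by metis
  have "\<exists>n. \<forall>x\<in>F. mdist m (f x) (a n x) < 3 * e" if F: "finite F" "F \<subseteq> topspace X" for F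
  proof -
    \<comment> \<open>At late stages a point of \<open>F\<close> in \<open>D\<close> is controlled through \<open>E n\<close>,
        and a point off \<open>D\<close> has left \<open>G n\<close>.\<close>
    have "\<exists>N. \<forall>n\<ge>N. if x \<in> D then x \<in> E n else x \<notin> G n" if "x \<in> F" for x
    proof (cases "x \<in> D")
      case True
      then have "\<forall>n\<ge>Suc (to_nat_on D x). x \<in> E n" by (simp add: E_def)
      with True show ?thesis by metis
    next
      case xD: False
      then have "x \<in> topspace X - D" using that F by blast
      with xD G'(2) show ?thesis by simp
    qed
    then obtain N where N: "\<And>x n. x \<in> F \<Longrightarrow> n \<ge> N x \<Longrightarrow> if x \<in> D then x \<in> E n else x \<notin> G n" by metis
    obtain n where n: "n \<ge> Max (insert 0 (N ` F))" "F \<subseteq> X closure_of u n"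
      using range_in_K_Omega_infinitely_often[OF u(2) F] by blast
    have "mdist m (f x) (a n x) < 3 * e" if x: "x \<in> F" for x
    proof (cases "x \<in> D")
      case True
      have "N x \<le> n" using n(1) x F(1) by simp
      then show ?thesis using N[OF x] True a(2)[of x n] e by fastforce
    next
      case xD: False
      have "N x \<le> n" using n(1) x F(1) by simp
      then have "x \<notin> G n" using N[OF x] xD by auto
      then show ?thesis using n(2) a(3)[of n] x by (auto simp: T_def)
    qed
    then show ?thesis by blast
  qed
  then show ?thesis using a(1) by blast
qed

text \<open>
  The indices \<open>prod_encode (k, n)\<close> with \<open>k\<close> fixed form the block used for the error
  \<open>3 / (k + 1)\<close>.
\<close>
lemma S_1_imp_strong_fan_tightness:
  fixes m :: "'b metric"
  assumes X: "metrizable_space X" and S: "S_1 (K_Omega X) (K_Omega X)"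
  shows "countable_strong_fan_tightness (Q_p X (mtopology_of m))"
  unfolding countable_strong_fan_tightness_def countable_strong_fan_tightness_at_def
proof (intro ballI allI impI, elim conjE)
  let ?Q = "Q_p X (mtopology_of m)"
  fix f and A :: "nat \<Rightarrow> ('a \<Rightarrow> 'b) set"
  assume f: "f \<in> topspace ?Q" and A: "\<forall>n. A n \<subseteq> topspace ?Q" and cl: "f \<in> (\<Inter>n. ?Q closure_of A n)"
  have fq: "quasicontinuous_map X (mtopology_of m) f" using f by (simp add: topspace_Q_p)
  have Aq: "quasicontinuous_map X (mtopology_of m) g" if "g \<in> A n" for n g
    using A that by (auto simp: topspace_Q_p)
  have approx: "\<exists>g\<in>A n. \<forall>x\<in>F. mdist m (f x) (g x) < e" if "finite F" "F \<subseteq> topspace X" "e > 0" for n F e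
    using cl that in_closure_of_Q_p_metric_iff[OF A[rule_format], of f n] by blast
  have "\<exists>b :: nat \<Rightarrow> 'a \<Rightarrow> 'b. (\<forall>n. b n \<in> A (prod_encode (k, n))) \<and>
     (\<forall>F. finite F \<and> F \<subseteq> topspace X \<longrightarrow> (\<exists>n. \<forall>x\<in>F. mdist m (f x) (b n x) < 3 * inverse (Suc k)))" for k
    by (rule S_1_imp_uniform_selection[OF X S fq, of "inverse (Suc k)" "\<lambda>n. A (prod_encode (k, n))"])
       (use Aq approx in auto)
  then obtain b where b: "\<And>k n. b k n \<in> A (prod_encode (k, n))"
    "\<And>k F. finite F \<Longrightarrow> F \<subseteq> topspace X \<Longrightarrow> \<exists>n. \<forall>x\<in>F. mdist m (f x) (b k n x) < 3 * inverse (Suc k)"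
    by metis
  define a where "a i = (case prod_decode i of (k, n) \<Rightarrow> b k n)" for i
  have aA: "a i \<in> A i" for i
    using b(1)[of "fst (prod_decode i)" "snd (prod_decode i)"] by (simp add: a_def case_prod_beta)
  have "f \<in> ?Q closure_of range a"
  proof (subst in_closure_of_Q_p_metric_iff)
    show "range a \<subseteq> topspace ?Q" using aA A by blast
    have "\<exists>g\<in>range a. \<forall>x\<in>F. mdist m (f x) (g x) < e"
      if F: "finite F" "F \<subseteq> topspace X" and e: "e > 0" for F e
    proof -
      obtain k where k: "inverse (real (Suc k)) < e / 3" using e reals_Archimedean[of "e/3"] by auto
      obtain n where n: "\<forall>x\<in>F. mdist m (f x) (b k n x) < 3 * inverse (Suc k)" using b(2)[OF F] by blast
      have "\<forall>x\<in>F. mdist m (f x) (a (prod_encode (k, n)) x) < e"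
        using n k by (fastforce simp: a_def)
      then show ?thesis by blast
    qed
    then show "f \<in> topspace ?Q \<and> (\<forall>F e. finite F \<and> F \<subseteq> topspace X \<and> 0 < e \<longrightarrow>
        (\<exists>g\<in>range a. \<forall>x\<in>F. mdist m (f x) (g x) < e))" using f by blast
  qed
  then show "\<exists>a. (\<forall>n. a n \<in> A n) \<and> f \<in> ?Q closure_of range a" using aA by blast
qed

section \<open>The equivalence\<close>

lemma const_in_topspace_Q_p:
  assumes "c \<in> topspace Y"
  shows "restrict (\<lambda>_. c) (topspace X) \<in> topspace (Q_p X Y)"
proof -
  have "quasicontinuous_map X Y (restrict (\<lambda>_. c) (topspace X))"
    by (rule quasicontinuous_map_cong[OF _ quasicontinuous_map_const[OF assms]]) simp
  then show ?thesis by (simp add: topspace_Q_p)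
qed

lemma exists_metric_on_type:
  obtains m :: "'b metric" where "mspace m = UNIV"
proof
  show "mspace (metric (UNIV :: 'b set, discrete_metric.dd)) = UNIV"
    by (rule Metric_space.mspace_metric[OF metric_M_dd])
qed

theorem theorem6p7:
  fixes X :: "'a topology"
  assumes "metrizable_space X"
    and "\<exists>(y::'b) y'. y \<noteq> y'"
    and "\<exists>(y::'c) y'. y \<noteq> y'"
  shows
    "((\<forall>Y :: 'b metric. (\<exists>y \<in> mspace Y. \<exists>y' \<in> mspace Y. y \<noteq> y') \<longrightarrow>
          countable_strong_fan_tightness (Q_p X (mtopology_of Y)))
        \<longleftrightarrow> S_1 (K_Omega X) (K_Omega X)) \<and>
     ((\<exists>Y :: 'c metric. (\<exists>y \<in> mspace Y. \<exists>y' \<in> mspace Y. y \<noteq> y') \<and>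
          (\<exists>f \<in> topspace (Q_p X (mtopology_of Y)).
             countable_strong_fan_tightness_at (Q_p X (mtopology_of Y)) f))
        \<longleftrightarrow> S_1 (K_Omega X) (K_Omega X)) \<and>
     ((\<exists>f \<in> topspace (Q_p X euclideanreal).
          countable_strong_fan_tightness_at (Q_p X euclideanreal) f)
        \<longleftrightarrow> S_1 (K_Omega X) (K_Omega X))"
proof -
  let ?S = "S_1 (K_Omega X) (K_Omega X)"
  have haus: "Hausdorff_space (mtopology_of m)" for m :: "'z metric"
    by (simp add: mtopology_of_def Metric_space.Hausdorff_space_mtopology)
  obtain m\<^sub>1 :: "'b metric" where m1: "mspace m\<^sub>1 = UNIV" by (rule exists_metric_on_type)
  obtain m\<^sub>2 :: "'c metric" where m2: "mspace m\<^sub>2 = UNIV" by (rule exists_metric_on_type)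
  have "?S" if H: "\<forall>Y :: 'b metric. (\<exists>y \<in> mspace Y. \<exists>y' \<in> mspace Y. y \<noteq> y') \<longrightarrow>
          countable_strong_fan_tightness (Q_p X (mtopology_of Y))"
  proof -
    obtain y y' :: 'b where y: "y \<noteq> y'" using assms(2) by blast
    have f: "restrict (\<lambda>_. y) (topspace X) \<in> topspace (Q_p X (mtopology_of m\<^sub>1))"
      by (rule const_in_topspace_Q_p) (simp add: m1)
    have "countable_strong_fan_tightness (Q_p X (mtopology_of m\<^sub>1))"
      using H[rule_format, of m\<^sub>1] y unfolding m1 by blast
    then have "countable_strong_fan_tightness_at (Q_p X (mtopology_of m\<^sub>1)) (restrict (\<lambda>_. y) (topspace X))"
      using f by (simp add: countable_strong_fan_tightness_def)
    then show ?S
      using strong_fan_tightness_imp_S_1[OF assms(1) haus, of y m\<^sub>1 y'] f m1 y by auto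
  qed
  moreover have "?S" if "\<exists>Y :: 'c metric. (\<exists>y \<in> mspace Y. \<exists>y' \<in> mspace Y. y \<noteq> y') \<and>
          (\<exists>f \<in> topspace (Q_p X (mtopology_of Y)).
             countable_strong_fan_tightness_at (Q_p X (mtopology_of Y)) f)"
    using that strong_fan_tightness_imp_S_1[OF assms(1) haus] by (metis topspace_mtopology_of)
  moreover have "?S" if "\<exists>f \<in> topspace (Q_p X euclideanreal).
          countable_strong_fan_tightness_at (Q_p X euclideanreal) f"
    using that strong_fan_tightness_imp_S_1[OF assms(1), of euclideanreal 0 1] by auto
  moreover have "\<exists>Y :: 'c metric. (\<exists>y \<in> mspace Y. \<exists>y' \<in> mspace Y. y \<noteq> y') \<and>
          (\<exists>f \<in> topspace (Q_p X (mtopology_of Y)).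
             countable_strong_fan_tightness_at (Q_p X (mtopology_of Y)) f)" if ?S
  proof -
    obtain y y' :: 'c where y: "y \<noteq> y'" using assms(3) by blast
    have "restrict (\<lambda>_. y) (topspace X) \<in> topspace (Q_p X (mtopology_of m\<^sub>2))"
      by (rule const_in_topspace_Q_p) (simp add: m2)
    then show ?thesis
      using S_1_imp_strong_fan_tightness[OF assms(1) that, of m\<^sub>2] y m2
      unfolding countable_strong_fan_tightness_def by (intro exI[of _ m\<^sub>2]) auto
  qed
  moreover have "\<exists>f \<in> topspace (Q_p X euclideanreal).
          countable_strong_fan_tightness_at (Q_p X euclideanreal) f" if ?S
  proof -
    have "restrict (\<lambda>_. 0) (topspace X) \<in> topspace (Q_p X euclideanreal)"
      by (rule const_in_topspace_Q_p) simp
    then show ?thesis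
      using S_1_imp_strong_fan_tightness[OF assms(1) that, of euclidean_metric]
      unfolding countable_strong_fan_tightness_def by auto
  qed
  ultimately show ?thesis
    using S_1_imp_strong_fan_tightness[OF assms(1)] by blast
qed

end
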